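(* Let $H:[0,1]\to[0,1]$ satisfy $H(0)=0$ and $H(1)=1$. If $\Lambda(H)\le\Lambda<\infty$ for some $\Lambda\ge1$, then $$H(p)\le h_\Lambda(p):=\frac{\Lambda p}{1+(\Lambda-1)p},\qquad p\in[0,1].$$
   Context: The odds-lift index of $H$ is $\Lambda(H)=\sup_{p\in(0,1)}\dfrac{H(p)/(1-H(p))}{p/(1-p)}$, with the convention $\Lambda(H)=+\infty$ if $H(p)=1$ for some $p\in(0,1)$. *)

theory Defs
  imports Complex_Main "HOL-Library.Extended_Real" "HOL-Library.FuncSet"
begin

text \<open>The first branch is needed because HOL's division by zero would otherwise give such a
  point \<open>p\<close> the value 0 in the supremum.\<close>

definition odds_lift_index :: "(real \<Rightarrow> real) \<Rightarrow> ereal" where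
  "odds_lift_index H =
     (if \<exists>p\<in>{0<..<1}. H p = 1 then \<infinity>
      else (SUP p\<in>{0<..<1}. ereal ((H p / (1 - H p)) / (p / (1 - p)))))"

definition odds_envelope :: "real \<Rightarrow> real \<Rightarrow> real" where
  "odds_envelope \<Lambda> p = \<Lambda> * p / (1 + (\<Lambda> - 1) * p)"

end

theory Submission imports Defs begin

text \<open>\<open>odds_envelope \<Lambda> p\<close> is the probability whose odds are \<Lambda>
  times those of p. For 0 < p < 1, the index bound compares the odds of \<open>H p\<close> with
  exactly these (\<open>odds_lift_index_le_ereal_iff\<close>); as odds increase with probability
  below 1, solving for \<open>H p\<close> gives the bound (\<open>le_odds_envelope\<close>). At 0
  and 1 equality holds.\<close>

text \<open>A finite bound excludes the infinite branch, and a supremum is bounded iff each term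
  is.\<close>

lemma odds_lift_index_le_ereal_iff:
  "odds_lift_index H \<le> ereal \<Lambda> \<longleftrightarrow>
     (\<forall>p\<in>{0<..<1}. H p \<noteq> 1 \<and> (H p / (1 - H p)) / (p / (1 - p)) \<le> \<Lambda>)"
  by (auto simp: odds_lift_index_def SUP_le_iff)

lemma le_odds_envelope:
  assumes p: "0 < p" "p < 1" and h: "h < 1" and \<Lambda>: "\<Lambda> \<ge> 1"
    and odds: "(h / (1 - h)) / (p / (1 - p)) \<le> \<Lambda>"
  shows "h \<le> odds_envelope \<Lambda> p"
proof -
  have "h / (1 - h) \<le> \<Lambda> * (p / (1 - p))"
    \<comment> \<open>The nested quotient is kept intact so that the positive odds
      \<open>p / (1 - p)\<close> move across as one factor.\<close>
    using odds p by (simp add: pos_divide_le_eq del: divide_divide_eq_left divide_divide_eq_right)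
  then have "h * (1 - p) \<le> \<Lambda> * p * (1 - h)"
    using p h by (simp add: field_simps)
  then have "h * (1 + (\<Lambda> - 1) * p) \<le> \<Lambda> * p"
    by (simp add: algebra_simps)
  moreover have "1 + (\<Lambda> - 1) * p > 0"
    using p \<Lambda> by (simp add: add_pos_nonneg)
  ultimately show ?thesis
    by (simp add: odds_envelope_def pos_le_divide_eq)
qed

theorem lemma1:
  fixes H :: "real \<Rightarrow> real" and \<Lambda> :: real
  assumes "H \<in> {0..1} \<rightarrow> {0..1}"
    and "H 0 = 0" and "H 1 = 1"
    and "\<Lambda> \<ge> 1"
    and "odds_lift_index H \<le> ereal \<Lambda>"
  shows "\<forall>p\<in>{0..1}. H p \<le> odds_envelope \<Lambda> p"
proof
  fix p :: real
  assume p: "p \<in> {0..1}"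
  then consider "p = 0" | "p = 1" | "0 < p" "p < 1" by fastforce
  then show "H p \<le> odds_envelope \<Lambda> p"
  proof cases
    case 3
    then have "H p \<noteq> 1" and odds: "(H p / (1 - H p)) / (p / (1 - p)) \<le> \<Lambda>"
      using assms(5) by (auto simp only: odds_lift_index_le_ereal_iff greaterThanLessThan_iff)
    \<comment> \<open>With \<open>H p \<noteq> 1\<close> this gives \<open>H p < 1\<close>, so that
      \<open>1 - H p\<close> is positive.\<close>
    moreover have "H p \<le> 1"
      using assms(1) p by (auto simp: Pi_iff)
    ultimately show ?thesis
      using le_odds_envelope[OF 3 _ assms(4) odds] by simp
  \<comment> \<open>At p = 1 the envelope is \<Lambda> / \<Lambda>, which is 1 because \<Lambda> is
    nonzero.\<close>
  qed (use assms in \<open>simp_all add: odds_envelope_def\<close>)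
qed

end
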